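(* There exists $\kappa\in C^{1,1/2}_c(\mathbb{R}^2;\mathbb{R})$ such that the kernel $K=\nabla^\perp\kappa=(-\partial_2\kappa,\partial_1\kappa)$ admits a flow $X$ (of $\mathcal{H}^1_I$, in the sense below) with $X(0,x)=x$ for all $x\in I$ and $X(t,I)=\{0\}$ for all sufficiently large $t>0$.
   Context: Let $I=[-1,1]\times\{0\}\subset\mathbb{R}^2$ and $\mathcal{H}^1_I$ the one-dimensional Hausdorff measure restricted to $I$. Given $K\in C(\mathbb{R}^2;\mathbb{R}^2)$, $K$ admits a flow $X\in C([0,\infty)\times I;\mathbb{R}^2)$, differentiable with respect to $t$, if $u(t,x)\coloneqq\int_I K(x-X(t,a))\,d\mathcal{H}^1_I(a)$ exists for all $t\in[0,\infty)$ and $x\in X(t,I)$, and $X$ is a trajectory map for $u$ on $I$, i.e. for every $a\in I$, $t\mapsto X(t,a)$ is differentiable for all $t\ge0$ with $\partial_tX(t,a)=u(t,X(t,a))$ and $X(0,a)=a$. *)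

theory Defs
  imports "HOL-Analysis.Analysis"
begin

definition segI :: "(real \<times> real) set" where
  "segI = {(a, 0) | a. a \<in> {-1..1}}"

text \<open>One-dimensional Hausdorff measure restricted to I = [-1,1] \<times> {0}:
  since I is an isometric copy of [-1,1], it is the push-forward of Lebesgue
  measure on [-1,1] under a \<mapsto> (a,0).\<close>

definition H1_I :: "(real \<times> real) measure" where
  "H1_I = distr (lebesgue_on {-1..1}) borel (\<lambda>a. (a, 0))"

definition pd1 :: "(real \<times> real \<Rightarrow> real) \<Rightarrow> real \<times> real \<Rightarrow> real" where
  "pd1 f x = frechet_derivative f (at x) (1, 0)"

definition pd2 :: "(real \<times> real \<Rightarrow> real) \<Rightarrow> real \<times> real \<Rightarrow> real" where
  "pd2 f x = frechet_derivative f (at x) (0, 1)"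

definition C11half_c :: "(real \<times> real \<Rightarrow> real) \<Rightarrow> bool" where
  "C11half_c f \<longleftrightarrow>
     f differentiable_on UNIV \<and>
     (\<exists>C. \<forall>x y. \<bar>pd1 f x - pd1 f y\<bar> \<le> C * dist x y powr (1/2) \<and>
                 \<bar>pd2 f x - pd2 f y\<bar> \<le> C * dist x y powr (1/2)) \<and>
     compact (closure {x. f x \<noteq> 0})"

definition perp_grad :: "(real \<times> real \<Rightarrow> real) \<Rightarrow> real \<times> real \<Rightarrow> real \<times> real" where
  "perp_grad f x = (- pd2 f x, pd1 f x)"

definition vel :: "(real \<times> real \<Rightarrow> real \<times> real) \<Rightarrow> (real \<Rightarrow> real \<times> real \<Rightarrow> real \<times> real)
                   \<Rightarrow> real \<Rightarrow> real \<times> real \<Rightarrow> real \<times> real" where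
  "vel K X t x = integral\<^sup>L H1_I (\<lambda>a. K (x - X t a))"

definition admits_flow :: "(real \<times> real \<Rightarrow> real \<times> real) \<Rightarrow> (real \<Rightarrow> real \<times> real \<Rightarrow> real \<times> real) \<Rightarrow> bool" where
  "admits_flow K X \<longleftrightarrow>
     continuous_on ({0..} \<times> segI) (\<lambda>(t, a). X t a) \<and>
     (\<forall>t\<ge>0. \<forall>x \<in> X t ` segI. integrable H1_I (\<lambda>a. K (x - X t a))) \<and>
     (\<forall>a \<in> segI. X 0 a = a \<and>
        (\<forall>t\<ge>0. ((\<lambda>s. X s a) has_vector_derivative vel K X t (X t a)) (at t within {0..})))"

end

theory Submission
  imports Defs "HOL-Complex_Analysis.Great_Picard"
begin

text \<open>The flow stays on the axis. With a profile \<open>f\<close> such that \<open>f' x = sqrt x\<close> for \<open>\<bar>x\<bar> \<le> 2\<close>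
  (the library's odd extension of the square root), the stream function
  \<open>(f (x1 + x2) - f (x1 - x2)) * cutoff x2\<close> generates on the axis the attractive velocity
  \<open>- sqrt x\<close>, and the problem becomes
  \<open>\<partial>\<^sub>t \<phi>(t, a) = - \<integral>\<^sub>I sqrt (\<phi>(t, a) - \<phi>(t, b)) db\<close>.
  Since the square root is increasing, gaps between particles only shrink. Euler polygons for
  Lipschitz regularisations inherit this, hence are equicontinuous, and by Arzela-Ascoli a
  subsequence converges to a solution. By oddness the centre stays at \<open>0\<close>, so the right end point
  \<open>m\<close> satisfies \<open>m' \<le> - sqrt m\<close> and reaches \<open>0\<close> in finite time.\<close>

subsection \<open>The kernel\<close>

text \<open>The library's \<open>sqrt\<close> is odd, so both signs occur. For arguments of equal
  sign subadditivity gives the constant 1. For opposite signs each of the two terms is at most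
  \<open>sqrt (x - y)\<close>, which gives the constant 2.\<close>

lemma abs_sqrt_diff_le: "\<bar>sqrt x - sqrt y\<bar> \<le> 2 * sqrt \<bar>x - y\<bar>"
proof -
  have *: "sqrt x - sqrt y \<le> 2 * sqrt (x - y)" if "y \<le> x" for x y :: real
  proof (cases "0 \<le> y \<or> x \<le> 0")
    case True
    then show ?thesis
    proof
      assume "0 \<le> y"
      then show ?thesis
        using sqrt_add_le_add_sqrt[of "x - y" y] that by simp (smt (verit) real_sqrt_ge_zero)
    next
      assume "x \<le> 0"
      then show ?thesis
        using sqrt_add_le_add_sqrt[of "x - y" "- x"] that
        by (simp add: real_sqrt_minus) (smt (verit) real_sqrt_ge_zero)
    qed
  next
    case False
    have "sqrt x \<le> sqrt (x - y)" "sqrt (- y) \<le> sqrt (x - y)"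
      using False by auto
    moreover have "sqrt (- y) = - sqrt y" by (rule real_sqrt_minus)
    ultimately show ?thesis by linarith
  qed
  show ?thesis
  proof (cases "y \<le> x")
    case True
    then show ?thesis using *[of y x] by simp
  next
    case False
    then show ?thesis using *[of x y] by (simp add: abs_if)
  qed
qed

section \<open>Algebra of bounded Hoelder functions with exponent 1/2\<close>

definition bounded_holder :: "('a::metric_space \<Rightarrow> real) \<Rightarrow> bool" where
  "bounded_holder u \<longleftrightarrow>
     (\<exists>B. \<forall>x. \<bar>u x\<bar> \<le> B) \<and> (\<exists>C. \<forall>x y. \<bar>u x - u y\<bar> \<le> C * sqrt (dist x y))"

lemma bounded_holderE:
  assumes "bounded_holder u"
  obtains B C where "B \<ge> 0" "C \<ge> 0" "\<And>x. \<bar>u x\<bar> \<le> B"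
    "\<And>x y. \<bar>u x - u y\<bar> \<le> C * sqrt (dist x y)"
proof -
  obtain B C where B: "\<And>x. \<bar>u x\<bar> \<le> B" and C: "\<And>x y. \<bar>u x - u y\<bar> \<le> C * sqrt (dist x y)"
    using assms by (auto simp: bounded_holder_def)
  have "\<bar>u x - u y\<bar> \<le> \<bar>C\<bar> * sqrt (dist x y)" for x y
    using C[of x y] by (meson abs_ge_self mult_right_mono order_trans real_sqrt_ge_zero zero_le_dist)
  moreover have "B \<ge> 0" using B[of undefined] by linarith
  ultimately show ?thesis using that[of B "\<bar>C\<bar>"] B by auto
qed

lemma bounded_holderI:
  assumes "\<And>x. \<bar>u x\<bar> \<le> B" "\<And>x y. \<bar>u x - u y\<bar> \<le> C * sqrt (dist x y)"
  shows "bounded_holder u"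
  using assms by (auto simp: bounded_holder_def)

lemma bounded_holder_const: "bounded_holder (\<lambda>x. c)"
  by (rule bounded_holderI[of _ "\<bar>c\<bar>" 0]) auto

lemma bounded_holder_add:
  assumes "bounded_holder u" "bounded_holder v"
  shows "bounded_holder (\<lambda>x. u x + v x)"
proof -
  obtain B C where u: "B \<ge> 0" "C \<ge> 0" "\<And>x. \<bar>u x\<bar> \<le> B"
    "\<And>x y. \<bar>u x - u y\<bar> \<le> C * sqrt (dist x y)"
    using assms(1) by (rule bounded_holderE) blast
  obtain B' C' where v: "B' \<ge> 0" "C' \<ge> 0" "\<And>x. \<bar>v x\<bar> \<le> B'"
    "\<And>x y. \<bar>v x - v y\<bar> \<le> C' * sqrt (dist x y)"
    using assms(2) by (rule bounded_holderE) blast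
  show ?thesis
  proof (rule bounded_holderI[of _ "B + B'" "C + C'"])
    fix x show "\<bar>u x + v x\<bar> \<le> B + B'" using u(3)[of x] v(3)[of x] by linarith
  next
    fix x y show "\<bar>u x + v x - (u y + v y)\<bar> \<le> (C + C') * sqrt (dist x y)"
      using u(4)[of x y] v(4)[of x y] by (simp add: distrib_right)
  qed
qed

text \<open>The product estimate pairs the Hoelder modulus of one factor with the sup bound of the
  other; this is why boundedness belongs to the class.\<close>

lemma bounded_holder_mult:
  assumes "bounded_holder u" "bounded_holder v"
  shows "bounded_holder (\<lambda>x. u x * v x)"
proof -
  obtain B C where u: "B \<ge> 0" "C \<ge> 0" "\<And>x. \<bar>u x\<bar> \<le> B"
    "\<And>x y. \<bar>u x - u y\<bar> \<le> C * sqrt (dist x y)"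
    using assms(1) by (rule bounded_holderE) blast
  obtain B' C' where v: "B' \<ge> 0" "C' \<ge> 0" "\<And>x. \<bar>v x\<bar> \<le> B'"
    "\<And>x y. \<bar>v x - v y\<bar> \<le> C' * sqrt (dist x y)"
    using assms(2) by (rule bounded_holderE) blast
  show ?thesis
  proof (rule bounded_holderI[of _ "B * B'" "B * C' + C * B'"])
    fix x show "\<bar>u x * v x\<bar> \<le> B * B'"
      using mult_mono[OF u(3)[of x] v(3)[of x] u(1)] by (simp add: abs_mult)
  next
    fix x y
    have "u x * v x - u y * v y = u x * (v x - v y) + (u x - u y) * v y"
      by (simp add: algebra_simps)
    then have "\<bar>u x * v x - u y * v y\<bar> \<le> \<bar>u x\<bar> * \<bar>v x - v y\<bar> + \<bar>u x - u y\<bar> * \<bar>v y\<bar>"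
      by (metis abs_mult abs_triangle_ineq)
    also have "\<dots> \<le> B * (C' * sqrt (dist x y)) + (C * sqrt (dist x y)) * B'"
      by (intro add_mono mult_mono u v) (use u v in auto)
    finally show "\<bar>u x * v x - u y * v y\<bar> \<le> (B * C' + C * B') * sqrt (dist x y)"
      by (simp add: algebra_simps)
  qed
qed

lemma bounded_holder_diff:
  assumes "bounded_holder u" "bounded_holder v"
  shows "bounded_holder (\<lambda>x. u x - v x)"
  using bounded_holder_add[OF assms(1) bounded_holder_mult[OF bounded_holder_const[of "-1"] assms(2)]]
  by simp

lemma bounded_holder_compose:
  assumes "bounded_holder u" and "\<And>x y. dist (g x) (g y) \<le> L * dist x y" "L \<ge> 0"
  shows "bounded_holder (\<lambda>x. u (g x))"
proof -
  obtain B C where u: "B \<ge> 0" "C \<ge> 0" "\<And>x. \<bar>u x\<bar> \<le> B"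
    "\<And>x y. \<bar>u x - u y\<bar> \<le> C * sqrt (dist x y)"
    using assms(1) by (rule bounded_holderE) blast
  show ?thesis
  proof (rule bounded_holderI[of _ B "C * sqrt L"])
    fix x y
    have "sqrt (dist (g x) (g y)) \<le> sqrt L * sqrt (dist x y)"
      using assms(2)[of x y] by (metis real_sqrt_le_iff real_sqrt_mult)
    then show "\<bar>u (g x) - u (g y)\<bar> \<le> C * sqrt L * sqrt (dist x y)"
      using u(4)[of "g x" "g y"] u(2) by (smt (verit) mult.assoc mult_left_mono)
  qed (use u in auto)
qed

text \<open>At distance at most 1 the distance is below its square root, so the Lipschitz bound
  suffices. At larger distance the sup bound \<open>2 * B\<close> takes over, hence the constant
  \<open>L + 2 * B\<close>.\<close>

lemma bounded_holder_lipschitz: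
  assumes B: "\<And>x. \<bar>u x\<bar> \<le> B" and L: "\<And>x y. \<bar>u x - u y\<bar> \<le> L * dist x y" "L \<ge> 0"
  shows "bounded_holder u"
proof (rule bounded_holderI[OF B])
  have "B \<ge> 0" using B[of undefined] by linarith
  fix x y
  show "\<bar>u x - u y\<bar> \<le> (L + 2 * B) * sqrt (dist x y)"
  proof (cases "dist x y \<le> 1")
    case True
    then have "dist x y \<le> sqrt (dist x y)"
      by (simp add: real_le_rsqrt power2_eq_square mult_left_le)
    then have "L * dist x y \<le> (L + 2 * B) * sqrt (dist x y)"
      using L(2) \<open>B \<ge> 0\<close> by (intro mult_mono) auto
    then show ?thesis using L(1)[of x y] by linarith
  next
    case False
    then have "(L + 2 * B) * 1 \<le> (L + 2 * B) * sqrt (dist x y)"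
      using L(2) \<open>B \<ge> 0\<close> by (intro mult_left_mono) auto
    then have "L + 2 * B \<le> (L + 2 * B) * sqrt (dist x y)" by simp
    then show ?thesis using B[of x] B[of y] L(2) by linarith
  qed
qed

text \<open>The exponent 1/2 of the kernel originates here: taking the odd square root turns a
  Lipschitz bound into a Hoelder bound.\<close>

lemma bounded_holder_sqrt:
  assumes B: "\<And>x. \<bar>u x\<bar> \<le> B" and L: "\<And>x y. \<bar>u x - u y\<bar> \<le> L * dist x y"
  shows "bounded_holder (\<lambda>x. sqrt (u x))"
proof (rule bounded_holderI)
  fix x show "\<bar>sqrt (u x)\<bar> \<le> sqrt B"
    using B[of x] by (simp add: abs_le_iff flip: real_sqrt_minus)
next
  fix x y
  have "sqrt \<bar>u x - u y\<bar> \<le> sqrt L * sqrt (dist x y)"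
    using L[of x y] by (simp flip: real_sqrt_mult)
  then show "\<bar>sqrt (u x) - sqrt (u y)\<bar> \<le> (2 * sqrt L) * sqrt (dist x y)"
    using abs_sqrt_diff_le[of "u x" "u y"] by linarith
qed

lemma continuous_on_bounded_holder:
  assumes "bounded_holder u"
  shows "continuous_on S u"
proof -
  obtain B C where u: "B \<ge> 0" "C \<ge> 0" "\<And>x. \<bar>u x\<bar> \<le> B"
    "\<And>x y. \<bar>u x - u y\<bar> \<le> C * sqrt (dist x y)"
    using assms by (rule bounded_holderE) blast
  have "isCont u x" for x
  proof -
    have "((\<lambda>y. C * sqrt (dist y x)) \<longlongrightarrow> C * sqrt (dist x x)) (at x)"
      by (intro tendsto_intros)
    then have "((\<lambda>y. C * sqrt (dist y x)) \<longlongrightarrow> 0) (at x)" by simp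
    moreover have "\<forall>\<^sub>F y in at x. norm (u y - u x) \<le> C * sqrt (dist y x)"
      using u(4) by (simp add: always_eventually)
    ultimately have "((\<lambda>y. u y - u x) \<longlongrightarrow> 0) (at x)"
      by (rule Lim_null_comparison[rotated])
    then show ?thesis by (simp add: isCont_def LIM_zero_iff)
  qed
  then show ?thesis by (simp add: continuous_at_imp_continuous_on)
qed

section \<open>Truncations that give the stream function compact support\<close>

definition tent :: "real \<Rightarrow> real" where
  "tent x = max 0 (min x (4 - x)) + min 0 (max x (- 4 - x))"

lemma tent_lipschitz: "\<bar>tent x - tent y\<bar> \<le> 2 * dist x y"
proof -
  have "\<bar>max 0 (min x (4 - x)) - max 0 (min y (4 - y))\<bar> \<le> \<bar>x - y\<bar>"
    by (auto simp: max_def min_def)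
  moreover have "\<bar>min 0 (max x (- 4 - x)) - min 0 (max y (- 4 - y))\<bar> \<le> \<bar>x - y\<bar>"
    by (auto simp: max_def min_def)
  moreover have "\<bar>a + b - (c + d)\<bar> \<le> 2 * e" if "\<bar>a - c\<bar> \<le> e" "\<bar>b - d\<bar> \<le> e" for a b c d e :: real
    using that by linarith
  ultimately show ?thesis unfolding tent_def dist_real_def by blast
qed

lemma tent_bound: "\<bar>tent x\<bar> \<le> 2"
  unfolding tent_def by (simp add: max_def min_def abs_if)

text \<open>Differences of two points of the segment lie in \<open>[-2,2]\<close>, so the truncation
  is invisible to particles that stay in the segment.\<close>

lemma tent_id: "\<bar>x\<bar> \<le> 2 \<Longrightarrow> tent x = x"
  unfolding tent_def by (simp add: max_def min_def abs_if split: if_splits)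

lemma tent_zero: "\<bar>x\<bar> \<ge> 4 \<Longrightarrow> tent x = 0"
  unfolding tent_def by (simp add: max_def min_def abs_if split: if_splits)

text \<open>Squaring the positive part makes the function continuously differentiable at
  \<open>-1\<close> and \<open>1\<close>. The value 1/2 at the origin compensates the factor 2 that
  arises on the axis from the two profile terms of the stream function.\<close>

definition cutoff :: "real \<Rightarrow> real" where
  "cutoff y = (max 0 (1 - y\<^sup>2))\<^sup>2 / 2"

definition cutoff' :: "real \<Rightarrow> real" where
  "cutoff' y = - 2 * y * max 0 (1 - y\<^sup>2)"

text \<open>In every combination of signs the linearisation error is at most
  \<open>(y - x)\<^sup>2\<close>, so the difference quotient is within
  \<open>\<bar>y - x\<bar>\<close> of the claimed derivative, also at the kink 0.\<close>

lemma DERIV_max_0_power2: "((\<lambda>x. (max 0 x)\<^sup>2) has_field_derivative 2 * max 0 x) (at (x::real))"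
proof -
  have "\<bar>((max 0 y)\<^sup>2 - (max 0 x)\<^sup>2) / (y - x) - 2 * max 0 x\<bar> \<le> \<bar>y - x\<bar>" if "y \<noteq> x" for y
  proof -
    have "\<bar>(max 0 y)\<^sup>2 - (max 0 x)\<^sup>2 - 2 * max 0 x * (y - x)\<bar> \<le> (y - x)\<^sup>2"
    proof -
      consider "x \<ge> 0" "y \<ge> 0" | "x \<ge> 0" "y < 0" | "x < 0" "y \<ge> 0" | "x < 0" "y < 0" by linarith
      then show ?thesis
      proof cases
        case 1
        have "y\<^sup>2 - x\<^sup>2 - 2 * x * (y - x) = (y - x)\<^sup>2" by (simp add: power2_eq_square algebra_simps)
        then show ?thesis using 1 by simp
      next
        case 2
        have "x * y \<le> 0" using 2 by (simp add: mult_nonneg_nonpos)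
        moreover have "(max 0 y)\<^sup>2 - (max 0 x)\<^sup>2 - 2 * max 0 x * (y - x) = x\<^sup>2 - 2 * (x * y)"
          using 2 by (simp add: power2_eq_square algebra_simps)
        moreover have "(y - x)\<^sup>2 = x\<^sup>2 - 2 * (x * y) + y\<^sup>2" by (simp add: power2_eq_square algebra_simps)
        ultimately show ?thesis using zero_le_power2[of x] zero_le_power2[of y] by linarith
      next
        case 3
        then have "y\<^sup>2 \<le> (y - x)\<^sup>2" by (intro power_mono) auto
        then show ?thesis using 3 by simp
      qed simp
    qed
    then have "\<bar>(max 0 y)\<^sup>2 - (max 0 x)\<^sup>2 - 2 * max 0 x * (y - x)\<bar> \<le> \<bar>y - x\<bar> * \<bar>y - x\<bar>"
      by (simp add: power2_eq_square)
    moreover have "((max 0 y)\<^sup>2 - (max 0 x)\<^sup>2) / (y - x) - 2 * max 0 x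
        = ((max 0 y)\<^sup>2 - (max 0 x)\<^sup>2 - 2 * max 0 x * (y - x)) / (y - x)"
      using that by (simp add: diff_divide_distrib)
    ultimately show ?thesis
      using that by (simp only: abs_divide) (simp add: divide_le_eq)
  qed
  then have "\<forall>\<^sub>F y in at x. norm (((max 0 y)\<^sup>2 - (max 0 x)\<^sup>2) / (y - x) - 2 * max 0 x) \<le> \<bar>y - x\<bar>"
    unfolding eventually_at_filter real_norm_def by (intro always_eventually) blast
  moreover have "((\<lambda>y. \<bar>y - x\<bar>) \<longlongrightarrow> 0) (at x)"
    by (auto intro!: tendsto_eq_intros)
  ultimately have "((\<lambda>y. ((max 0 y)\<^sup>2 - (max 0 x)\<^sup>2) / (y - x) - 2 * max 0 x) \<longlongrightarrow> 0) (at x)"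
    by (rule Lim_null_comparison)
  then show ?thesis unfolding has_field_derivative_iff by (rule LIM_zero_cancel)
qed

lemma DERIV_cutoff: "(cutoff has_field_derivative cutoff' y) (at y)"
proof -
  have "((\<lambda>y. 1 - y\<^sup>2) has_field_derivative - 2 * y) (at y)"
    by (auto intro!: derivative_eq_intros)
  from DERIV_cdivide[OF DERIV_chain[OF DERIV_max_0_power2 this], of 2]
  show ?thesis by (simp add: cutoff_def[abs_def] cutoff'_def o_def algebra_simps)
qed

lemma bounded_holder_cutoff: "bounded_holder cutoff" "bounded_holder cutoff'"
proof -
  \<comment> \<open>Clamping to \<open>[-1,1]\<close> writes both functions as polynomials in the
    bounded Lipschitz function \<open>c\<close>, to which the algebra of the class applies. In
    \<open>cutoff'\<close> the factor \<open>y\<close> may be clamped as well, since the other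
    factor vanishes wherever clamping changes it.\<close>
  define c where "c y = max (-1) (min 1 y)" for y :: real
  have c: "bounded_holder c"
    by (rule bounded_holder_lipschitz[of _ 1 1]) (auto simp: c_def dist_real_def)
  have c2: "max 0 (1 - y\<^sup>2) = 1 - c y * c y" for y
  proof (cases "\<bar>y\<bar> \<le> 1")
    case True
    then have "c y = y" "y\<^sup>2 \<le> 1"
      using abs_le_square_iff[of y 1] by (auto simp: c_def)
    then show ?thesis by (simp add: power2_eq_square)
  next
    case False
    then have "y\<^sup>2 > 1" using abs_le_square_iff[of y 1] by auto
    then show ?thesis using False by (auto simp: c_def max_def min_def)
  qed
  have eq: "cutoff = (\<lambda>y. (1 - c y * c y) * (1 - c y * c y) * (1 / 2))"
    by (simp only: cutoff_def c2 fun_eq_iff) (simp add: power2_eq_square)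
  show "bounded_holder cutoff"
    unfolding eq by (intro bounded_holder_mult bounded_holder_diff bounded_holder_const c)
  have "cutoff' y = (-2) * c y * (1 - c y * c y)" for y
  proof (cases "\<bar>y\<bar> \<le> 1")
    case True
    then have "c y = y" by (auto simp: c_def)
    then show ?thesis unfolding cutoff'_def c2 by simp
  next
    case False
    then have "c y * c y = 1" by (auto simp: c_def max_def min_def)
    then show ?thesis unfolding cutoff'_def c2 by simp
  qed
  then have eq: "cutoff' = (\<lambda>y. (-2) * c y * (1 - c y * c y))" by blast
  show "bounded_holder cutoff'"
    unfolding eq by (intro bounded_holder_mult bounded_holder_diff bounded_holder_const c)
qed

text \<open>An antiderivative of the truncated odd square root is Lipschitz with constant
  \<open>sqrt 2\<close>, as \<open>tent\<close> is bounded by 2. It is constant on either side of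
  \<open>[-4,4]\<close>, hence bounded.\<close>

lemma ex_profile:
  obtains f :: "real \<Rightarrow> real" where
    "\<And>x. (f has_field_derivative sqrt (tent x)) (at x)" "bounded_holder f"
    "\<And>x. x \<ge> 4 \<Longrightarrow> f x = f 4" "\<And>x. x \<le> - 4 \<Longrightarrow> f x = f (- 4)"
proof -
  have "isCont (\<lambda>x. sqrt (tent x)) x" for x
    unfolding tent_def by (intro continuous_intros)
  then obtain f where f: "\<And>x. (f has_field_derivative sqrt (tent x)) (at x)"
    using einterval_antiderivative[of "-\<infinity>" "\<infinity>" "\<lambda>x. sqrt (tent x)"]
    by (auto simp: has_real_derivative_iff_has_vector_derivative)
  have zero: "(f has_field_derivative 0) (at x within S)" if "\<bar>x\<bar> \<ge> 4" for x S
    using f[of x] tent_zero[OF that] by (simp add: has_field_derivative_at_within)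
  have pos: "f x = f 4" if "x \<ge> 4" for x
    using has_field_derivative_zero_constant[of "{4..}" f] zero that by fastforce
  have neg: "f x = f (- 4)" if "x \<le> - 4" for x
    using has_field_derivative_zero_constant[of "{..- 4}" f] zero that by fastforce
  have lip: "\<bar>f x - f y\<bar> \<le> sqrt 2 * dist x y" for x y
  proof -
    have "norm (sqrt (tent x)) \<le> sqrt 2" for x
      using tent_bound[of x] by (simp flip: real_sqrt_abs2)
    then show ?thesis
      using field_differentiable_bound[of UNIV f "\<lambda>x. sqrt (tent x)" "sqrt 2" x y] f
      by (simp add: dist_real_def)
  qed
  have bd: "\<bar>f x\<bar> \<le> \<bar>f 0\<bar> + sqrt 2 * 4" for x
  proof -
    have *: "\<bar>f x\<bar> \<le> \<bar>f 0\<bar> + sqrt 2 * 4" if "\<bar>x\<bar> \<le> 4" for x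
    proof -
      have "sqrt 2 * dist x 0 \<le> sqrt 2 * 4" using that by simp
      then show ?thesis using lip[of x 0] by linarith
    qed
    consider "\<bar>x\<bar> \<le> 4" | "x \<ge> 4" | "x \<le> -4" by linarith
    then show ?thesis
    proof cases
      case 2
      then show ?thesis using *[of 4] pos[of x] by simp
    next
      case 3
      then show ?thesis using *[of "-4"] neg[of x] by simp
    qed (rule *)
  qed
  have "bounded_holder f" by (rule bounded_holder_lipschitz[OF bd lip]) simp
  then show ?thesis using that f pos neg by blast
qed

lemma ex_kernel:
  obtains \<kappa> where "C11half_c \<kappa>" "continuous_on UNIV (perp_grad \<kappa>)"
    "\<And>x. \<bar>x\<bar> \<le> 2 \<Longrightarrow> perp_grad \<kappa> (x, 0) = (- sqrt x, 0)"
    "\<exists>B. \<forall>x. norm (perp_grad \<kappa> x) \<le> B"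
proof -
  obtain f where f: "\<And>x. (f has_field_derivative sqrt (tent x)) (at x)" "bounded_holder f"
    "\<And>x. x \<ge> 4 \<Longrightarrow> f x = f 4" "\<And>x. x \<le> - 4 \<Longrightarrow> f x = f (- 4)"
    by (rule ex_profile) blast
  define q where "q x = sqrt (tent x)" for x
  \<comment> \<open>\<open>k1\<close> and \<open>k2\<close> are the partial derivatives. On the axis
    the two \<open>q\<close> terms cancel in \<open>k1\<close> and add up in \<open>k2\<close>,
    while the term with \<open>cutoff'\<close> drops out because its profile difference is
    zero.\<close>
  define \<kappa> where "\<kappa> p = (f (fst p + snd p) - f (fst p - snd p)) * cutoff (snd p)" for p :: "real \<times> real"
  define k1 where "k1 p = (q (fst p + snd p) - q (fst p - snd p)) * cutoff (snd p)" for p :: "real \<times> real"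
  define k2 where "k2 p = (q (fst p + snd p) + q (fst p - snd p)) * cutoff (snd p)
      + (f (fst p + snd p) - f (fst p - snd p)) * cutoff' (snd p)" for p :: "real \<times> real"
  have der: "(\<kappa> has_derivative (\<lambda>v. fst v * k1 p + snd v * k2 p)) (at p)" for p
  proof -
    have *: "((\<lambda>p. u (g p)) has_derivative (\<lambda>v. g' v * d)) (at p)"
      if "(u has_field_derivative d) (at (g p))" "(g has_derivative g') (at p)"
      for u :: "real \<Rightarrow> real" and d g g'
      using has_derivative_compose[OF that(2) that(1)[unfolded has_field_derivative_def]]
      by (simp add: mult.commute)
    have 1: "((\<lambda>p. f (fst p + snd p)) has_derivative (\<lambda>v. (fst v + snd v) * q (fst p + snd p))) (at p)"
      unfolding q_def by (rule *[OF f(1)]) (auto intro!: derivative_eq_intros)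
    have 2: "((\<lambda>p. f (fst p - snd p)) has_derivative (\<lambda>v. (fst v - snd v) * q (fst p - snd p))) (at p)"
      unfolding q_def by (rule *[OF f(1)]) (auto intro!: derivative_eq_intros)
    have 3: "((\<lambda>p. cutoff (snd p)) has_derivative (\<lambda>v. snd v * cutoff' (snd p))) (at p)"
      by (rule *[OF DERIV_cutoff]) (auto intro!: derivative_eq_intros)
    show ?thesis
      unfolding \<kappa>_def k1_def k2_def
      by (rule derivative_eq_intros 1 2 3 refl)+ (auto simp: algebra_simps)
  qed
  have fd: "frechet_derivative \<kappa> (at p) = (\<lambda>v. fst v * k1 p + snd v * k2 p)" for p
    using frechet_derivative_at[OF der] by simp
  have pd: "pd1 \<kappa> = k1" "pd2 \<kappa> = k2"
    by (auto simp: pd1_def pd2_def fd)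
  have q: "bounded_holder q"
    unfolding q_def by (rule bounded_holder_sqrt[OF tent_bound tent_lipschitz])
  have fstsnd: "dist (fst x) (fst y) \<le> dist x y" "dist (snd x) (snd y) \<le> dist x y" for x y :: "real \<times> real"
    by (rule dist_fst_le, rule dist_snd_le)
  have comp: "bounded_holder (\<lambda>p::real\<times>real. u (fst p + snd p))"
    "bounded_holder (\<lambda>p::real\<times>real. u (fst p - snd p))" "bounded_holder (\<lambda>p::real\<times>real. u (snd p))"
    if "bounded_holder u" for u :: "real \<Rightarrow> real"
  proof -
    have "dist (fst x + snd x) (fst y + snd y) \<le> 2 * dist x y"
      "dist (fst x - snd x) (fst y - snd y) \<le> 2 * dist x y" for x y :: "real \<times> real"
      using fstsnd[of x y] by (auto simp: dist_real_def)
    then show "bounded_holder (\<lambda>p::real\<times>real. u (fst p + snd p))"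
      "bounded_holder (\<lambda>p::real\<times>real. u (fst p - snd p))"
      by (auto intro!: bounded_holder_compose[OF that, of _ 2])
    show "bounded_holder (\<lambda>p::real\<times>real. u (snd p))"
      by (rule bounded_holder_compose[OF that, of _ 1]) (auto simp: fstsnd)
  qed
  have k1: "bounded_holder k1" and k2: "bounded_holder k2"
    unfolding k1_def k2_def
    by (intro bounded_holder_add bounded_holder_diff bounded_holder_mult comp bounded_holder_cutoff q f)+
  obtain B1 C1 where k1b: "B1 \<ge> 0" "C1 \<ge> 0" "\<And>x. \<bar>k1 x\<bar> \<le> B1"
    "\<And>x y. \<bar>k1 x - k1 y\<bar> \<le> C1 * sqrt (dist x y)"
    using k1 by (rule bounded_holderE) blast
  obtain B2 C2 where k2b: "B2 \<ge> 0" "C2 \<ge> 0" "\<And>x. \<bar>k2 x\<bar> \<le> B2"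
    "\<And>x y. \<bar>k2 x - k2 y\<bar> \<le> C2 * sqrt (dist x y)"
    using k2 by (rule bounded_holderE) blast
  have pg: "perp_grad \<kappa> = (\<lambda>x. (- k2 x, k1 x))"
    by (auto simp: perp_grad_def pd)
  show ?thesis
  proof
    \<comment> \<open>The cutoff confines \<open>snd x\<close> to \<open>[-1,1]\<close>. If in
      addition \<open>fst x\<close> is beyond 5 in absolute value, both arguments of
      \<open>f\<close> are beyond 4 on the same side, where \<open>f\<close> is constant and the
      difference vanishes.\<close>
    have supp: "{x. \<kappa> x \<noteq> 0} \<subseteq> {-5..5} \<times> {-1..1}"
    proof
      fix x assume "x \<in> {x. \<kappa> x \<noteq> 0}"
      then have nz: "cutoff (snd x) \<noteq> 0" "f (fst x + snd x) \<noteq> f (fst x - snd x)"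
        by (auto simp: \<kappa>_def)
      have s: "\<bar>snd x\<bar> \<le> 1"
        using nz(1) abs_le_square_iff[of "snd x" 1] by (auto simp: cutoff_def max_def split: if_splits)
      have "\<not> fst x > 5"
        using nz(2) s f(3)[of "fst x + snd x"] f(3)[of "fst x - snd x"] by linarith
      moreover have "\<not> fst x < - 5"
        using nz(2) s f(4)[of "fst x + snd x"] f(4)[of "fst x - snd x"] by linarith
      ultimately show "x \<in> {-5..5} \<times> {-1..1}" using s by (cases x) auto
    qed
    have "bounded {x. \<kappa> x \<noteq> 0}"
      by (rule bounded_subset[OF _ supp]) (intro bounded_Times bounded_closed_interval)
    moreover have "\<exists>C. \<forall>x y. \<bar>k1 x - k1 y\<bar> \<le> C * dist x y powr (1 / 2) \<and>
        \<bar>k2 x - k2 y\<bar> \<le> C * dist x y powr (1 / 2)"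
    proof (intro exI[of _ "C1 + C2"] allI conjI)
      fix x y :: "real \<times> real"
      have "C1 * sqrt (dist x y) \<le> (C1 + C2) * sqrt (dist x y)"
        "C2 * sqrt (dist x y) \<le> (C1 + C2) * sqrt (dist x y)"
        using k1b(2) k2b(2) by (intro mult_right_mono; simp)+
      then show "\<bar>k1 x - k1 y\<bar> \<le> (C1 + C2) * dist x y powr (1 / 2)"
        "\<bar>k2 x - k2 y\<bar> \<le> (C1 + C2) * dist x y powr (1 / 2)"
        using k1b(4)[of x y] k2b(4)[of x y] by (auto simp: powr_half_sqrt)
    qed
    moreover have "\<kappa> differentiable_on UNIV"
      using der by (auto simp: differentiable_on_def differentiable_def)
    ultimately show "C11half_c \<kappa>"
      by (simp add: C11half_c_def pd)
    show "continuous_on UNIV (perp_grad \<kappa>)"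
      unfolding pg by (intro continuous_intros continuous_on_bounded_holder k1 k2)
    show "perp_grad \<kappa> (x, 0) = (- sqrt x, 0)" if "\<bar>x\<bar> \<le> 2" for x
      using tent_id[OF that] by (simp add: pg k1_def k2_def q_def cutoff_def)
    have "norm (perp_grad \<kappa> x) \<le> B1 + B2" for x
      using norm_Pair_le[of "- k2 x" "k1 x"] k1b(3)[of x] k2b(3)[of x] by (simp add: pg)
    then show "\<exists>B. \<forall>x. norm (perp_grad \<kappa> x) \<le> B" by blast
  qed
qed

subsection \<open>Euler polygons\<close>

text \<open>Shifting the argument by \<open>r\<^sup>2\<close> avoids the infinite slope at 0, and
  subtracting \<open>r\<close> restores the value 0 there. The second branch is the odd reflection
  of the first, written with the odd library root.\<close>

definition rsqrt :: "real \<Rightarrow> real \<Rightarrow> real" where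
  "rsqrt r x = (if 0 \<le> x then sqrt (x + r\<^sup>2) - r else sqrt (x - r\<^sup>2) + r)"

lemma rsqrt_0: "0 < r \<Longrightarrow> rsqrt r 0 = 0"
  by (simp add: rsqrt_def)

lemma rsqrt_minus: "0 < r \<Longrightarrow> rsqrt r (- x) = - rsqrt r x"
  using real_sqrt_minus[of "x + r\<^sup>2"] real_sqrt_minus[of "x - r\<^sup>2"]
  by (auto simp: rsqrt_def)

text \<open>The shifted roots \<open>u\<close> and \<open>v\<close> are at least \<open>r\<close>,
  and \<open>(v - u) * (v + u)\<close> equals \<open>y - x\<close>; dividing by
  \<open>v + u\<close>, which is at least \<open>2 * r\<close>, gives the slope bound.\<close>

lemma rsqrt_diff_nonneg:
  assumes "0 < r" "0 \<le> x" "x \<le> y"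
  shows "0 \<le> rsqrt r y - rsqrt r x \<and> rsqrt r y - rsqrt r x \<le> (y - x) / (2 * r)"
proof -
  define u v where "u = sqrt (x + r\<^sup>2)" and "v = sqrt (y + r\<^sup>2)"
  have "r \<le> u" "u \<le> v" "u\<^sup>2 = x + r\<^sup>2" "v\<^sup>2 = y + r\<^sup>2"
    using assms by (auto simp: u_def v_def intro!: real_le_rsqrt)
  then have "(v - u) * (2 * r) \<le> (v - u) * (v + u)"
    using assms by (intro mult_left_mono) auto
  also have "\<dots> = y - x"
    using \<open>u\<^sup>2 = x + r\<^sup>2\<close> \<open>v\<^sup>2 = y + r\<^sup>2\<close> by (simp add: power2_eq_square algebra_simps)
  finally have "v - u \<le> (y - x) / (2 * r)"
    using assms by (simp add: pos_le_divide_eq)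
  then show ?thesis
    using assms \<open>u \<le> v\<close> by (simp add: rsqrt_def u_def v_def)
qed

text \<open>Oddness transfers the estimate to negative arguments, and an interval that straddles 0
  is split there.\<close>

lemma rsqrt_diff:
  assumes "0 < r" "x \<le> y"
  shows "0 \<le> rsqrt r y - rsqrt r x" "rsqrt r y - rsqrt r x \<le> (y - x) / (2 * r)"
proof -
  have "0 \<le> rsqrt r y - rsqrt r x \<and> rsqrt r y - rsqrt r x \<le> (y - x) / (2 * r)"
  proof -
    consider "0 \<le> x" | "y \<le> 0" | "x < 0" "0 < y" by linarith
    then show ?thesis
    proof cases
      case 2
      then show ?thesis
        using rsqrt_diff_nonneg[of r "- y" "- x"] assms by (simp add: rsqrt_minus)
    next
      case 3
      then show ?thesis
        using rsqrt_diff_nonneg[of r 0 "- x"] rsqrt_diff_nonneg[of r 0 y] assms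
        by (simp add: rsqrt_minus rsqrt_0 diff_divide_distrib)
    qed (use rsqrt_diff_nonneg assms in blast)
  qed
  then show "0 \<le> rsqrt r y - rsqrt r x" "rsqrt r y - rsqrt r x \<le> (y - x) / (2 * r)" by auto
qed

text \<open>For nonnegative \<open>x\<close>, \<open>sqrt (x + r\<^sup>2)\<close> lies between
  \<open>sqrt x\<close> and \<open>sqrt x + r\<close>; oddness covers the rest.\<close>

lemma rsqrt_approx:
  assumes "0 < r"
  shows "\<bar>rsqrt r x - sqrt x\<bar> \<le> r"
proof -
  have *: "\<bar>rsqrt r x - sqrt x\<bar> \<le> r" if "0 \<le> x" for x
    using that assms sqrt_add_le_add_sqrt[of x "r\<^sup>2"] real_sqrt_le_mono[of x "x + r\<^sup>2"]
    by (simp add: rsqrt_def abs_le_iff)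
  show ?thesis
    using *[of x] *[of "- x"] assms by (cases "0 \<le> x") (auto simp: rsqrt_minus real_sqrt_minus)
qed

lemma continuous_on_rsqrt:
  assumes "0 < r"
  shows "continuous_on S (rsqrt r)"
proof -
  have "\<bar>rsqrt r x - rsqrt r y\<bar> \<le> 1 / (2 * r) * \<bar>x - y\<bar>" for x y
    using rsqrt_diff[OF assms, of x y] rsqrt_diff[OF assms, of y x] by (cases "x \<le> y") auto
  then have "(1 / (2 * r))-lipschitz_on S (rsqrt r)"
    using assms by (intro lipschitz_onI) (auto simp: dist_real_def)
  then show ?thesis by (rule lipschitz_on_continuous_on)
qed

text \<open>The invariants of the evolution of the particle positions; the contraction bound
  supplies the equicontinuity in the label.\<close>

definition admissible :: "(real \<Rightarrow> real) \<Rightarrow> bool" where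
  "admissible \<Phi> \<longleftrightarrow>
     (\<forall>a\<in>{-1..1}. \<forall>b\<in>{-1..1}. a \<le> b \<longrightarrow> 0 \<le> \<Phi> b - \<Phi> a \<and> \<Phi> b - \<Phi> a \<le> b - a) \<and>
     (\<forall>a\<in>{-1..1}. \<Phi> (- a) = - \<Phi> a)"

lemma admissible_lipschitz:
  assumes "admissible \<Phi>" "a \<in> {-1..1}" "b \<in> {-1..1}"
  shows "\<bar>\<Phi> a - \<Phi> b\<bar> \<le> \<bar>a - b\<bar>"
proof (cases "a \<le> b")
  case True
  then have "0 \<le> \<Phi> b - \<Phi> a \<and> \<Phi> b - \<Phi> a \<le> b - a" using assms by (simp add: admissible_def)
  then show ?thesis by linarith
next
  case False
  then have "0 \<le> \<Phi> a - \<Phi> b \<and> \<Phi> a - \<Phi> b \<le> a - b" using assms by (simp add: admissible_def)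
  then show ?thesis by linarith
qed

lemma admissible_bound:
  assumes "admissible \<Phi>" "a \<in> {-1..1}" "b \<in> {-1..1}"
  shows "\<bar>\<Phi> a - \<Phi> b\<bar> \<le> 2"
  using admissible_lipschitz[OF assms] assms(2,3) by (auto simp: abs_le_iff)

lemma admissible_continuous:
  assumes "admissible \<Phi>"
  shows "continuous_on {-1..1} \<Phi>"
proof -
  have "1-lipschitz_on {-1..1} \<Phi>"
    using admissible_lipschitz[OF assms] by (intro lipschitz_onI) (auto simp: dist_real_def)
  then show ?thesis by (rule lipschitz_on_continuous_on)
qed

text \<open>The sign is chosen so that the drift increases with the position: particles move with
  velocity \<open>- drift\<close>.\<close>

definition drift :: "real \<Rightarrow> (real \<Rightarrow> real) \<Rightarrow> real \<Rightarrow> real" where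
  "drift r \<Phi> a = integral {-1..1} (\<lambda>b. rsqrt r (\<Phi> a - \<Phi> b))"

lemma drift_integrable:
  assumes "0 < r" "admissible \<Phi>"
  shows "(\<lambda>b. rsqrt r (x - \<Phi> b)) integrable_on {-1..1}"
  by (intro integrable_continuous_real continuous_on_compose2[OF continuous_on_rsqrt[OF assms(1), of UNIV]]
      continuous_intros admissible_continuous assms) auto

text \<open>The root contributes at most 2 and the regularisation error at most 1. Integrated over a
  segment of length 2 this yields the speed bound 6.\<close>

lemma rsqrt_bound:
  assumes "0 < r" "r \<le> 1" "\<bar>x\<bar> \<le> 2"
  shows "\<bar>rsqrt r x\<bar> \<le> 3"
proof -
  have "sqrt x \<le> sqrt 4" "sqrt (- x) \<le> sqrt 4"
    using assms(3) by (intro real_sqrt_le_mono; linarith)+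
  then have "\<bar>sqrt x\<bar> \<le> 2" by (simp add: real_sqrt_minus)
  then show ?thesis using rsqrt_approx[OF assms(1), of x] assms(2) by linarith
qed

lemma abs_integral_le:
  fixes f :: "real \<Rightarrow> real"
  assumes "f integrable_on {a..b}" "a \<le> b" "\<And>x. x \<in> {a..b} \<Longrightarrow> \<bar>f x\<bar> \<le> C"
  shows "\<bar>integral {a..b} f\<bar> \<le> C * (b - a)"
proof -
  have "0 \<le> C" using assms(2) assms(3)[of a] by auto
  then show ?thesis
    using has_integral_bound[of C f "integral {a..b} f" a b] assms integrable_integral
    by (simp add: has_integral_integral)
qed

lemma drift_bound:
  assumes "0 < r" "r \<le> 1" "admissible \<Phi>" "a \<in> {-1..1}"
  shows "\<bar>drift r \<Phi> a\<bar> \<le> 6"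
  using abs_integral_le[OF drift_integrable[OF assms(1,3), of "\<Phi> a"], of 3]
    rsqrt_bound[OF assms(1,2) admissible_bound[OF assms(3,4)]]
  by (simp add: drift_def)

text \<open>Substituting \<open>- b\<close> for \<open>b\<close> in the integral reduces the claim
  to the oddness of \<open>\<Phi>\<close> and of \<open>rsqrt\<close>.\<close>

lemma drift_minus:
  assumes "0 < r" "admissible \<Phi>" "a \<in> {-1..1}"
  shows "drift r \<Phi> (- a) = - drift r \<Phi> a"
proof -
  have "drift r \<Phi> (- a) = integral {-1..1} (\<lambda>b. rsqrt r (\<Phi> (- a) - \<Phi> (- b)))"
    using Henstock_Kurzweil_Integration.integral_reflect_real[of 1 "-1" "\<lambda>b. rsqrt r (\<Phi> (- a) - \<Phi> b)"]
    by (simp add: drift_def)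
  also have "\<dots> = integral {-1..1} (\<lambda>b. - rsqrt r (\<Phi> a - \<Phi> b))"
  proof (rule integral_cong)
    fix b :: real assume "b \<in> {-1..1}"
    then have "\<Phi> (- a) - \<Phi> (- b) = - (\<Phi> a - \<Phi> b)"
      using assms by (simp add: admissible_def)
    then show "rsqrt r (\<Phi> (- a) - \<Phi> (- b)) = - rsqrt r (\<Phi> a - \<Phi> b)"
      by (simp only: rsqrt_minus[OF assms(1)])
  qed
  finally show ?thesis by (simp add: drift_def)
qed

text \<open>The pointwise bounds on \<open>rsqrt\<close> are integrated over a segment of length 2,
  which turns the slope \<open>1 / (2 * r)\<close> into \<open>1 / r\<close>.\<close>

lemma drift_diff:
  assumes "0 < r" "admissible \<Phi>" "a \<in> {-1..1}" "b \<in> {-1..1}" "a \<le> b"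
  shows "0 \<le> drift r \<Phi> b - drift r \<Phi> a" "drift r \<Phi> b - drift r \<Phi> a \<le> (\<Phi> b - \<Phi> a) / r"
proof -
  have le: "\<Phi> a \<le> \<Phi> b" using assms by (force simp: admissible_def)
  have eq: "drift r \<Phi> b - drift r \<Phi> a
      = integral {-1..1} (\<lambda>c. rsqrt r (\<Phi> b - \<Phi> c) - rsqrt r (\<Phi> a - \<Phi> c))"
    unfolding drift_def by (rule integral_diff[symmetric]) (intro drift_integrable assms)+
  have int: "(\<lambda>c. rsqrt r (\<Phi> b - \<Phi> c) - rsqrt r (\<Phi> a - \<Phi> c)) integrable_on {-1..1}"
    by (intro integrable_diff drift_integrable assms)
  have r: "0 \<le> rsqrt r (\<Phi> b - \<Phi> c) - rsqrt r (\<Phi> a - \<Phi> c)"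
    "rsqrt r (\<Phi> b - \<Phi> c) - rsqrt r (\<Phi> a - \<Phi> c) \<le> (\<Phi> b - \<Phi> a) / (2 * r)" for c
    using rsqrt_diff[OF assms(1), of "\<Phi> a - \<Phi> c" "\<Phi> b - \<Phi> c"] le by auto
  show "0 \<le> drift r \<Phi> b - drift r \<Phi> a"
    unfolding eq using r by (intro integral_nonneg int) auto
  have "\<bar>drift r \<Phi> b - drift r \<Phi> a\<bar> \<le> (\<Phi> b - \<Phi> a) / (2 * r) * (1 - - 1)"
    unfolding eq by (rule abs_integral_le[OF int]) (use r in auto)
  also have "\<dots> = (\<Phi> b - \<Phi> a) / r" using assms(1) by (simp add: field_simps)
  finally show "drift r \<Phi> b - drift r \<Phi> a \<le> (\<Phi> b - \<Phi> a) / r" by simp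
qed

text \<open>A step shortens the gap between two particles by \<open>\<tau> * d\<close> with
  \<open>0 \<le> \<tau> * d \<le> r * d\<close>, and \<open>r * d\<close> is at most the gap itself.
  So gaps neither grow nor change sign.\<close>

lemma admissible_step:
  assumes "0 < r" "admissible \<Phi>" "0 \<le> \<tau>" "\<tau> \<le> r"
  shows "admissible (\<lambda>a. \<Phi> a - \<tau> * drift r \<Phi> a)"
  unfolding admissible_def
proof (intro conjI ballI impI)
  fix a b :: real assume ab: "a \<in> {-1..1}" "b \<in> {-1..1}" "a \<le> b"
  define d where "d = drift r \<Phi> b - drift r \<Phi> a"
  have g: "0 \<le> \<Phi> b - \<Phi> a" "\<Phi> b - \<Phi> a \<le> b - a"
    using assms(2) ab by (auto simp: admissible_def)
  have d: "0 \<le> d" "r * d \<le> \<Phi> b - \<Phi> a"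
    using drift_diff[OF assms(1,2) ab] assms(1) by (auto simp: d_def pos_le_divide_eq mult.commute)
  have "\<tau> * d \<le> r * d" "0 \<le> \<tau> * d" using d assms by (auto intro: mult_right_mono)
  moreover have "\<Phi> b - \<tau> * drift r \<Phi> b - (\<Phi> a - \<tau> * drift r \<Phi> a) = \<Phi> b - \<Phi> a - \<tau> * d"
    by (simp add: d_def algebra_simps)
  ultimately show "0 \<le> \<Phi> b - \<tau> * drift r \<Phi> b - (\<Phi> a - \<tau> * drift r \<Phi> a)"
    "\<Phi> b - \<tau> * drift r \<Phi> b - (\<Phi> a - \<tau> * drift r \<Phi> a) \<le> b - a"
    using g d by linarith+
next
  fix a :: real assume "a \<in> {-1..1}"
  then show "\<Phi> (- a) - \<tau> * drift r \<Phi> (- a) = - (\<Phi> a - \<tau> * drift r \<Phi> a)"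
    using drift_minus[OF assms(1,2)] assms(2) by (simp add: admissible_def)
qed

text \<open>The time step equals the regularisation parameter: \<^term>\<open>rsqrt r\<close> has Lipschitz
  constant \<open>1 / (2 * r)\<close> and the segment has mass 2, so a step of length at most \<open>r\<close> preserves
  the order of the particles.\<close>

primrec euler :: "real \<Rightarrow> nat \<Rightarrow> real \<Rightarrow> real" where
  "euler r 0 = (\<lambda>a. a)"
| "euler r (Suc j) = (\<lambda>a. euler r j a - r * drift r (euler r j) a)"

lemma admissible_euler: "0 < r \<Longrightarrow> admissible (euler r j)"
proof (induction j)
  case 0
  then show ?case by (simp add: admissible_def)
next
  case (Suc j)
  then show ?case using admissible_step[of r "euler r j" r] by simp
qed

text \<open>Linear interpolation in time of the Euler iterates, with nodes at the multiples of
  \<open>r\<close>.\<close>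

definition polygon :: "real \<Rightarrow> real \<Rightarrow> real \<Rightarrow> real" where
  "polygon r t a = (let j = nat \<lfloor>t / r\<rfloor> in euler r j a - (t - real j * r) * drift r (euler r j) a)"

lemma polygon_cell:
  assumes "0 < r" "real j * r \<le> t" "t \<le> real (Suc j) * r"
  shows "polygon r t a = euler r j a - (t - real j * r) * drift r (euler r j) a"
\<comment> \<open>At the right end of the cell the floor already selects the next index; the formula
  persists because it reproduces the Euler step there.\<close>
proof (cases "t = real (Suc j) * r")
  case True
  then have "nat \<lfloor>t / r\<rfloor> = Suc j" using assms(1) by (simp del: of_nat_Suc)
  then show ?thesis using True by (simp add: polygon_def Let_def algebra_simps)
next
  case False
  then have "\<lfloor>t / r\<rfloor> = int j"
    using assms by (intro floor_unique) (auto simp: pos_le_divide_eq pos_divide_less_eq algebra_simps)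
  then show ?thesis by (simp add: polygon_def)
qed

lemma ex_cell:
  assumes "0 < r" "0 \<le> t"
  obtains j where "real j * r \<le> t" "t \<le> real (Suc j) * r"
proof -
  have "real (nat \<lfloor>t / r\<rfloor>) \<le> t / r" "t / r \<le> real (Suc (nat \<lfloor>t / r\<rfloor>))"
    using assms by auto linarith
  then show ?thesis
    using that[of "nat \<lfloor>t / r\<rfloor>"] assms(1) by (simp only: pos_le_divide_eq pos_divide_le_eq)
qed

lemma admissible_polygon:
  assumes "0 < r" "0 \<le> t"
  shows "admissible (polygon r t)"
proof -
  obtain j where j: "real j * r \<le> t" "t \<le> real (Suc j) * r"
    using ex_cell[OF assms] by blast
  have "polygon r t = (\<lambda>a. euler r j a - (t - real j * r) * drift r (euler r j) a)"
    using polygon_cell[OF assms(1) j] by blast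
  moreover have "t - real j * r \<le> r" using j(2) by (simp add: distrib_right)
  ultimately show ?thesis
    using admissible_step[OF assms(1) admissible_euler[OF assms(1)], of "t - real j * r" j] j by simp
qed

lemma polygon_0: "0 < r \<Longrightarrow> polygon r 0 a = a"
  by (simp add: polygon_def)

text \<open>Cellwise estimates add up along the nodes, by induction on the number of cells that
  reach \<open>t\<close>. It serves both the speed bound of the polygons and the error estimate
  against the limit.\<close>

lemma lipschitz_from_cells:
  fixes g :: "real \<Rightarrow> real"
  assumes "0 < h"
    and cell: "\<And>j s t. \<lbrakk>real j * h \<le> s; s \<le> t; t \<le> real (Suc j) * h; t \<le> T\<rbrakk> \<Longrightarrow> \<bar>g t - g s\<bar> \<le> C * (t - s)"
    and "0 \<le> s" "s \<le> t" "t \<le> T"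
  shows "\<bar>g t - g s\<bar> \<le> C * (t - s)"
proof -
  have *: "\<lbrakk>0 \<le> s; s \<le> t; t \<le> T; t \<le> real j * h\<rbrakk> \<Longrightarrow> \<bar>g t - g s\<bar> \<le> C * (t - s)" for j s t
  proof (induction j arbitrary: s t)
    case 0
    then have "s = t" by simp
    then show ?case by simp
  next
    case (Suc j)
    consider "t \<le> real j * h" | "real j * h \<le> s" | "s < real j * h" "real j * h < t" by linarith
    then show ?case
    proof cases
      case 3
      then have "\<bar>g t - g (real j * h)\<bar> \<le> C * (t - real j * h)"
        using Suc.prems by (intro cell) auto
      moreover have "\<bar>g (real j * h) - g s\<bar> \<le> C * (real j * h - s)"
        using Suc.prems 3 by (intro Suc.IH) auto
      ultimately show ?thesis unfolding right_diff_distrib by linarith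
    qed (use Suc cell in auto)
  qed
  obtain j where "t \<le> real (Suc j) * h" using ex_cell[OF assms(1), of t] assms(3,4) order_trans by meson
  then show ?thesis using * assms by blast
qed

lemma polygon_lipschitz:
  assumes "0 < r" "r \<le> 1" "a \<in> {-1..1}" "0 \<le> s" "s \<le> t"
  shows "\<bar>polygon r t a - polygon r s a\<bar> \<le> 6 * (t - s)"
proof (rule lipschitz_from_cells[OF assms(1) _ assms(4,5) order_refl])
  fix j u v assume *: "real j * r \<le> u" "u \<le> v" "v \<le> real (Suc j) * r"
  then have "polygon r v a - polygon r u a = - (v - u) * drift r (euler r j) a"
    using polygon_cell[OF assms(1), of j u a] polygon_cell[OF assms(1), of j v a] by (simp add: algebra_simps)
  then have "\<bar>polygon r v a - polygon r u a\<bar> = \<bar>drift r (euler r j) a\<bar> * (v - u)"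
    using *(2) by (simp add: abs_mult)
  also have "\<dots> \<le> 6 * (v - u)"
    using drift_bound[OF assms(1,2) admissible_euler[OF assms(1)] assms(3)] *(2)
    by (intro mult_right_mono) auto
  finally show "\<bar>polygon r v a - polygon r u a\<bar> \<le> 6 * (v - u)" .
qed

subsection \<open>Passage to the limit\<close>

lemma polygon_limit:
  obtains \<phi> k where "continuous_on ({0..T} \<times> {-1..1}) \<phi>" "strict_mono (k :: nat \<Rightarrow> nat)"
    "\<And>e. 0 < e \<Longrightarrow> \<exists>N. \<forall>n t a. n \<ge> N \<and> t \<in> {0..T} \<and> a \<in> {-1..1} \<longrightarrow>
        \<bar>polygon (1 / real (Suc (k n))) t a - \<phi> (t, a)\<bar> < e"
proof -
  define F where "F n p = polygon (1 / real (Suc n)) (fst p) (snd p)" for n p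
  have r: "0 < 1 / real (Suc n)" "1 / real (Suc n) \<le> 1" for n by auto
  \<comment> \<open>The constant 7 is the speed bound 6 in time plus the constant 1 of the
    contraction in the label. It does not depend on \<open>n\<close>, so the family is
    equicontinuous.\<close>
  have lip: "\<bar>F n p - F n q\<bar> \<le> 7 * norm (p - q)"
    if pq: "p \<in> {0..T} \<times> {-1..1}" "q \<in> {0..T} \<times> {-1..1}" for n p q
  proof -
    obtain t a s b where [simp]: "p = (t, a)" "q = (s, b)" by (cases p, cases q)
    have mem: "0 \<le> t" "0 \<le> s" "a \<in> {-1..1}" "b \<in> {-1..1}" using pq by auto
    have 1: "\<bar>polygon (1 / real (Suc n)) t a - polygon (1 / real (Suc n)) s a\<bar> \<le> 6 * \<bar>t - s\<bar>"
      using polygon_lipschitz[OF r mem(3), of s t n] polygon_lipschitz[OF r mem(3), of t s n] mem(1,2)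
      by (cases "s \<le> t") auto
    have 2: "\<bar>polygon (1 / real (Suc n)) s a - polygon (1 / real (Suc n)) s b\<bar> \<le> \<bar>a - b\<bar>"
      using admissible_lipschitz[OF admissible_polygon[OF r(1) mem(2)] mem(3,4)] .
    have "\<bar>t - s\<bar> \<le> norm (p - q)" "\<bar>a - b\<bar> \<le> norm (p - q)"
      using norm_fst_le[of "t - s" "a - b"] norm_snd_le[of "a - b" "t - s"] by auto
    then show ?thesis using 1 2 by (simp add: F_def) argo
  qed
  have "compact ({0..T} \<times> {-1..1::real})" by (intro compact_Times compact_Icc)
  moreover have "norm (F n p) \<le> 1 + 6 * \<bar>T\<bar>" if "p \<in> {0..T} \<times> {-1..1}" for n p
  proof -
    obtain t a where [simp]: "p = (t, a)" by (cases p)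
    have mem: "0 \<le> t" "t \<le> T" "a \<in> {-1..1}" using that by auto
    have "\<bar>polygon (1 / real (Suc n)) t a - a\<bar> \<le> 6 * (t - 0)"
      using polygon_lipschitz[OF r mem(3), of 0 t n] mem(1) polygon_0[OF r(1)] by simp
    then show ?thesis using mem by (auto simp: F_def)
  qed
  moreover have "\<exists>d>0. \<forall>n q. q \<in> {0..T} \<times> {-1..1} \<and> norm (p - q) < d \<longrightarrow> norm (F n p - F n q) < e"
    if "p \<in> {0..T} \<times> {-1..1}" "0 < e" for p e
  proof (intro exI[of _ "e / 7"] conjI allI impI)
    fix n q assume "q \<in> {0..T} \<times> {-1..1} \<and> norm (p - q) < e / 7"
    then show "norm (F n p - F n q) < e" using lip[of p q n] that by (simp add: pos_less_divide_eq)
  qed (use that in auto)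
  ultimately obtain \<phi> k where "continuous_on ({0..T} \<times> {-1..1}) \<phi>" "strict_mono (k :: nat \<Rightarrow> nat)"
    "\<And>e. 0 < e \<Longrightarrow> \<exists>N. \<forall>n p. n \<ge> N \<and> p \<in> {0..T} \<times> {-1..1} \<longrightarrow> norm (F (k n) p - \<phi> p) < e"
    by (rule Arzela_Ascoli[of _ F]) blast+
  then show ?thesis
    by (intro that[of \<phi> k]) (auto simp: F_def)
qed

lemma admissible_limit:
  assumes "\<And>n. admissible (\<Phi> n)" "\<And>a. a \<in> {-1..1} \<Longrightarrow> (\<lambda>n. \<Phi> n a) \<longlonglongrightarrow> \<psi> a"
  shows "admissible \<psi>"
  unfolding admissible_def
proof (intro conjI ballI impI)
  fix a b :: real assume ab: "a \<in> {-1..1}" "b \<in> {-1..1}" "a \<le> b"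
  have lim: "(\<lambda>n. \<Phi> n b - \<Phi> n a) \<longlonglongrightarrow> \<psi> b - \<psi> a"
    by (intro tendsto_diff assms ab)
  have "0 \<le> \<Phi> n b - \<Phi> n a" "\<Phi> n b - \<Phi> n a \<le> b - a" for n
    using assms(1)[of n] ab by (auto simp: admissible_def)
  then show "0 \<le> \<psi> b - \<psi> a" "\<psi> b - \<psi> a \<le> b - a"
    by (intro LIMSEQ_le_const[OF lim] LIMSEQ_le_const2[OF lim]; blast)+
next
  fix a :: real assume a: "a \<in> {-1..1}"
  have "(\<lambda>n. \<Phi> n (- a)) \<longlonglongrightarrow> \<psi> (- a)" using a by (intro assms) auto
  moreover have "\<Phi> n (- a) = - \<Phi> n a" for n using assms(1)[of n] a by (simp add: admissible_def)
  moreover have "(\<lambda>n. - \<Phi> n a) \<longlonglongrightarrow> - \<psi> a" by (intro tendsto_minus assms a)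
  ultimately show "\<psi> (- a) = - \<psi> a" using LIMSEQ_unique by simp
qed

definition sqrt_drift :: "(real \<times> real \<Rightarrow> real) \<Rightarrow> real \<Rightarrow> real \<Rightarrow> real" where
  "sqrt_drift \<phi> a s = integral {-1..1} (\<lambda>b. sqrt (\<phi> (s, a) - \<phi> (s, b)))"

lemma continuous_on_sqrt_drift:
  assumes "continuous_on (S \<times> {-1..1}) \<phi>" "a \<in> {-1..1}"
  shows "continuous_on S (sqrt_drift \<phi> a)"
    and "s \<in> S \<Longrightarrow> (\<lambda>b. sqrt (\<phi> (s, a) - \<phi> (s, b))) integrable_on {-1..1}"
proof -
  have c: "continuous_on (S \<times> {-1..1}) (\<lambda>(s, b). sqrt (\<phi> (s, a) - \<phi> (s, b)))"
    unfolding case_prod_beta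
    by (intro continuous_intros continuous_on_compose2[OF assms(1)]) (use assms(2) in auto)
  then show "continuous_on S (sqrt_drift \<phi> a)"
    using integral_continuous_on_param[of S "-1" 1 "\<lambda>s b. sqrt (\<phi> (s, a) - \<phi> (s, b))"]
    by (simp add: sqrt_drift_def[abs_def])
  assume "s \<in> S"
  then show "(\<lambda>b. sqrt (\<phi> (s, a) - \<phi> (s, b))) integrable_on {-1..1}"
    by (intro integrable_continuous_real continuous_on_compose2[OF c, of _ "\<lambda>b. (s, b)", simplified]
      continuous_intros) auto
qed

text \<open>Two errors enter the integrand: \<open>r\<close> from the regularisation, and
  \<open>2 * sqrt (2 * \<delta>)\<close> from the Hoelder bound, since the differences of positions
  deviate by at most \<open>2 * \<delta>\<close>. The leading 2 is the length of the
  segment.\<close>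

lemma drift_approx:
  assumes "0 < r" "admissible \<Phi>" "(\<lambda>b. sqrt (\<phi> (s, a) - \<phi> (s, b))) integrable_on {-1..1}"
    and "a \<in> {-1..1}" "\<And>b. b \<in> {-1..1} \<Longrightarrow> \<bar>\<Phi> b - \<phi> (s, b)\<bar> \<le> \<delta>"
  shows "\<bar>drift r \<Phi> a - sqrt_drift \<phi> a s\<bar> \<le> 2 * (r + 2 * sqrt (2 * \<delta>))"
proof -
  have int: "(\<lambda>b. rsqrt r (\<Phi> a - \<Phi> b) - sqrt (\<phi> (s, a) - \<phi> (s, b))) integrable_on {-1..1}"
    by (intro integrable_diff drift_integrable assms)
  have "drift r \<Phi> a - sqrt_drift \<phi> a s
      = integral {-1..1} (\<lambda>b. rsqrt r (\<Phi> a - \<Phi> b) - sqrt (\<phi> (s, a) - \<phi> (s, b)))"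
    unfolding drift_def sqrt_drift_def
    by (rule integral_diff[symmetric]) (intro drift_integrable assms)+
  also have "\<bar>\<dots>\<bar> \<le> (r + 2 * sqrt (2 * \<delta>)) * (1 - - 1)"
  proof (rule abs_integral_le[OF int])
    fix b :: real assume b: "b \<in> {-1..1}"
    have "sqrt \<bar>(\<Phi> a - \<Phi> b) - (\<phi> (s, a) - \<phi> (s, b))\<bar> \<le> sqrt (2 * \<delta>)"
      using assms(5)[OF b] assms(5)[OF assms(4)] by (intro real_sqrt_le_mono) linarith
    then show "\<bar>rsqrt r (\<Phi> a - \<Phi> b) - sqrt (\<phi> (s, a) - \<phi> (s, b))\<bar> \<le> r + 2 * sqrt (2 * \<delta>)"
      using rsqrt_approx[OF assms(1), of "\<Phi> a - \<Phi> b"]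
        abs_sqrt_diff_le[of "\<Phi> a - \<Phi> b" "\<phi> (s, a) - \<phi> (s, b)"] by linarith
  qed simp
  finally show ?thesis by simp
qed

lemma polygon_near_solution:
  assumes r: "0 < r" "r \<le> 1" and cont: "continuous_on ({0..T} \<times> {-1..1}) \<phi>"
    and e: "\<And>t a. \<lbrakk>t \<in> {0..T}; a \<in> {-1..1}\<rbrakk> \<Longrightarrow> \<bar>polygon r t a - \<phi> (t, a)\<bar> \<le> e"
    and a: "a \<in> {-1..1}" and t: "t \<in> {0..T}"
  shows "\<bar>polygon r t a - a + integral {0..t} (sqrt_drift \<phi> a)\<bar> \<le> 2 * (r + 2 * sqrt (2 * (6 * r + e))) * t"
proof -
  define \<eta> where "\<eta> = 2 * (r + 2 * sqrt (2 * (6 * r + e)))"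
  \<comment> \<open>This is the defect of the polygon in the limiting integral equation. It vanishes
    at time 0 and is shown to be Lipschitz with the small constant \<open>\<eta>\<close>.\<close>
  define g where "g t = polygon r t a - a + integral {0..t} (sqrt_drift \<phi> a)" for t
  have cd: "continuous_on {0..T} (sqrt_drift \<phi> a)"
    by (rule continuous_on_sqrt_drift[OF cont a])
  have "\<bar>g t - g 0\<bar> \<le> \<eta> * (t - 0)"
  proof (rule lipschitz_from_cells[OF r(1), where T = T])
    fix j s t assume *: "real j * r \<le> s" "s \<le> t" "t \<le> real (Suc j) * r" "t \<le> T"
    have s0: "0 \<le> s" using *(1) r(1) by (smt (verit) mult_nonneg_nonneg of_nat_0_le_iff)
    define D where "D = drift r (euler r j) a"
    have cst: "continuous_on {s..t} (sqrt_drift \<phi> a)"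
      by (rule continuous_on_subset[OF cd]) (use s0 * in auto)
    have pd: "polygon r t a - polygon r s a = - integral {s..t} (\<lambda>_. D)"
      using polygon_cell[OF r(1), of j s a] polygon_cell[OF r(1), of j t a] *
      by (simp add: D_def algebra_simps)
    have "integral {0..s} (sqrt_drift \<phi> a) + integral {s..t} (sqrt_drift \<phi> a) = integral {0..t} (sqrt_drift \<phi> a)"
      by (rule Henstock_Kurzweil_Integration.integral_combine)
        (use s0 * in \<open>auto intro!: integrable_continuous_real continuous_on_subset[OF cd]\<close>)
    then have "g t - g s = integral {s..t} (sqrt_drift \<phi> a) - integral {s..t} (\<lambda>_. D)"
      using pd by (simp add: g_def)
    also have "\<dots> = integral {s..t} (\<lambda>u. sqrt_drift \<phi> a u - D)"
      by (rule integral_diff[symmetric]) (intro integrable_continuous_real cst continuous_intros)+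
    also have "\<bar>\<dots>\<bar> \<le> \<eta> * (t - s)"
    proof (rule abs_integral_le)
      show "(\<lambda>u. sqrt_drift \<phi> a u - D) integrable_on {s..t}"
        by (intro integrable_continuous_real cst continuous_intros)
      fix u assume u: "u \<in> {s..t}"
      then have uT: "u \<in> {0..T}" "real j * r \<le> u" "u - real j * r \<le> r"
        using s0 * by (auto simp: algebra_simps)
      \<comment> \<open>Within the cell the drift is frozen at its left node. Moving from there to
        time \<open>u\<close> costs at most \<open>6 * r\<close>, and passing from the polygon to
        \<open>\<phi>\<close> costs \<open>e\<close>.\<close>
      have "\<bar>euler r j b - \<phi> (u, b)\<bar> \<le> 6 * r + e" if b: "b \<in> {-1..1}" for b
      proof -
        have "polygon r (real j * r) b = euler r j b"
          using polygon_cell[OF r(1), of j "real j * r" b] r(1) by (simp add: distrib_right)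
        moreover have "\<bar>polygon r u b - polygon r (real j * r) b\<bar> \<le> 6 * (u - real j * r)"
          using r uT by (intro polygon_lipschitz b) auto
        ultimately have "\<bar>polygon r u b - euler r j b\<bar> \<le> 6 * (u - real j * r)" by simp
        then have "\<bar>polygon r u b - euler r j b\<bar> \<le> 6 * r" using uT(3) by argo
        then show ?thesis using e[OF uT(1) b] by argo
      qed
      then have "\<bar>D - sqrt_drift \<phi> a u\<bar> \<le> \<eta>"
        unfolding D_def \<eta>_def
        by (intro drift_approx admissible_euler r continuous_on_sqrt_drift(2)[OF cont a] uT a)
      then show "\<bar>sqrt_drift \<phi> a u - D\<bar> \<le> \<eta>" by (simp add: abs_minus_commute)
    qed (use * in simp)
    finally show "\<bar>g t - g s\<bar> \<le> \<eta> * (t - s)" .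
  qed (use t in auto)
  then show ?thesis using polygon_0[OF r(1)] by (simp add: g_def \<eta>_def)
qed

lemma ex_sqrt_flow:
  obtains \<phi> where "continuous_on ({0..T} \<times> {-1..1}) \<phi>"
    "\<And>t. t \<in> {0..T} \<Longrightarrow> admissible (\<lambda>a. \<phi> (t, a))"
    "\<And>t a. \<lbrakk>t \<in> {0..T}; a \<in> {-1..1}\<rbrakk> \<Longrightarrow> \<phi> (t, a) = a - integral {0..t} (sqrt_drift \<phi> a)"
proof -
  obtain \<phi> k where cont: "continuous_on ({0..T} \<times> {-1..1}) \<phi>" and k: "strict_mono (k :: nat \<Rightarrow> nat)"
    and unif: "\<And>e. 0 < e \<Longrightarrow> \<exists>N. \<forall>n t a. n \<ge> N \<and> t \<in> {0..T} \<and> a \<in> {-1..1} \<longrightarrow>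
        \<bar>polygon (1 / real (Suc (k n))) t a - \<phi> (t, a)\<bar> < e"
    by (rule polygon_limit) blast
  define r where "r n = 1 / real (Suc (k n))" for n
  have r: "0 < r n" "r n \<le> 1" for n by (auto simp: r_def)
  have lim: "(\<lambda>n. polygon (r n) t a) \<longlonglongrightarrow> \<phi> (t, a)" if "t \<in> {0..T}" "a \<in> {-1..1}" for t a
    using unif that by (fastforce simp: LIMSEQ_iff r_def)
  have r0: "r \<longlonglongrightarrow> 0"
    using LIMSEQ_subseq_LIMSEQ[OF LIMSEQ_inverse_real_of_nat k]
    by (simp add: r_def[abs_def] o_def inverse_eq_divide)
  have eq: "\<phi> (t, a) - a + integral {0..t} (sqrt_drift \<phi> a) = 0"
    if t: "t \<in> {0..T}" and a: "a \<in> {-1..1}" for t a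
  proof -
    define G where "G = \<phi> (t, a) - a + integral {0..t} (sqrt_drift \<phi> a)"
    \<comment> \<open>With \<open>n\<close> so large that both the uniform distance and
      \<open>r n\<close> are below \<open>e\<close>, the quantity \<open>2 * (6 * r n + e)\<close>
      is at most \<open>14 * e\<close>. As \<open>G\<close> does not involve \<open>n\<close>,
      letting \<open>e\<close> tend to 0 afterwards forces it to vanish.\<close>
    have bound: "\<bar>G\<bar> \<le> 2 * (e + 2 * sqrt (14 * e)) * t + e" if "0 < e" for e
    proof -
      obtain N where N: "\<And>n t a. \<lbrakk>n \<ge> N; t \<in> {0..T}; a \<in> {-1..1}\<rbrakk> \<Longrightarrow> \<bar>polygon (r n) t a - \<phi> (t, a)\<bar> < e"
        using unif[OF \<open>0 < e\<close>] unfolding r_def by blast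
      obtain n where n: "n \<ge> N" "r n < e"
        using order_tendstoD(2)[OF r0 \<open>0 < e\<close>] by (metis eventually_sequentially nle_le)
      have "\<bar>polygon (r n) t a - a + integral {0..t} (sqrt_drift \<phi> a)\<bar>
          \<le> 2 * (r n + 2 * sqrt (2 * (6 * r n + e))) * t"
        by (rule polygon_near_solution[OF r cont _ a t]) (use N[OF n(1)] in \<open>auto intro: less_imp_le\<close>)
      also have "\<dots> \<le> 2 * (e + 2 * sqrt (14 * e)) * t"
      proof -
        have "sqrt (2 * (6 * r n + e)) \<le> sqrt (14 * e)" using n by (intro real_sqrt_le_mono) simp
        then have "2 * (r n + 2 * sqrt (2 * (6 * r n + e))) \<le> 2 * (e + 2 * sqrt (14 * e))"
          using n by argo
        then show ?thesis using t by (intro mult_right_mono) auto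
      qed
      finally show ?thesis using N[OF n(1) t a] unfolding G_def by linarith
    qed
    have "((\<lambda>e. 2 * (e + 2 * sqrt (14 * e)) * t + e) \<longlongrightarrow> 2 * (0 + 2 * sqrt (14 * 0)) * t + 0) (at_right 0)"
      by (intro tendsto_intros)
    then have "\<bar>G\<bar> \<le> 2 * (0 + 2 * sqrt (14 * 0)) * t + 0"
      by (rule tendsto_lowerbound) (use bound in \<open>auto simp: eventually_at_right_less eventually_at_filter\<close>)
    then show ?thesis by (simp add: G_def)
  qed
  show ?thesis
  proof
    show "admissible (\<lambda>a. \<phi> (t, a))" if "t \<in> {0..T}" for t
      by (rule admissible_limit[of "\<lambda>n. polygon (r n) t"]) (use that r lim admissible_polygon in auto)
    show "\<phi> (t, a) = a - integral {0..t} (sqrt_drift \<phi> a)" if "t \<in> {0..T}" "a \<in> {-1..1}" for t a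
      using eq[OF that] by simp
  qed (rule cont)
qed

subsection \<open>Collapse\<close>

lemma sqrt_flow_collapses:
  assumes cont: "continuous_on ({0..4} \<times> {-1..1}) \<phi>"
    and adm: "\<And>t. t \<in> {0..4} \<Longrightarrow> admissible (\<lambda>a. \<phi> (t, a))"
    and eq: "\<And>t a. \<lbrakk>t \<in> {0..4}; a \<in> {-1..1}\<rbrakk> \<Longrightarrow> \<phi> (t, a) = a - integral {0..t} (sqrt_drift \<phi> a)"
    and a: "a \<in> {-1..1}"
  shows "\<phi> (4, a) = 0"
proof -
  define m where "m t = \<phi> (t, 1)" for t
  have zero: "\<phi> (t, 0) = 0" if "t \<in> {0..4}" for t
    using adm[OF that] by (auto simp: admissible_def dest: bspec[of _ _ 0])
  have mono: "\<phi> (t, b) \<le> \<phi> (t, c)" if "t \<in> {0..4}" "b \<in> {-1..1}" "c \<in> {-1..1}" "b \<le> c" for t b c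
    using adm[OF that(1)] that(2-) by (force simp: admissible_def)
  have m_nonneg: "0 \<le> m t" if "t \<in> {0..4}" for t
    using mono[OF that, of 0 1] zero[OF that] by (simp add: m_def)
  \<comment> \<open>Particles with label in \<open>[-1,0]\<close> have positions at most 0, hence
    lie at distance at least \<open>m t\<close> from the right end point. These labels have total
    length 1, and the other labels contribute nonnegatively.\<close>
  have drift_ge: "sqrt (m t) \<le> sqrt_drift \<phi> 1 t" if t: "t \<in> {0..4}" for t
  proof -
    have int: "(\<lambda>b. sqrt (\<phi> (t, 1) - \<phi> (t, b))) integrable_on {-1..1}"
      by (rule continuous_on_sqrt_drift(2)[OF cont _ t]) simp
    have int': "(\<lambda>b. sqrt (\<phi> (t, 1) - \<phi> (t, b))) integrable_on {-1..0}"
      by (rule integrable_subinterval_real[OF int]) auto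
    have "sqrt (m t) = integral {-1..0::real} (\<lambda>b. sqrt (m t))" by simp
    also have "\<dots> \<le> integral {-1..0} (\<lambda>b. sqrt (\<phi> (t, 1) - \<phi> (t, b)))"
    proof (rule integral_le[OF _ int'])
      fix b :: real assume "b \<in> {-1..0}"
      then have "\<phi> (t, b) \<le> 0" using mono[OF t, of b 0] zero[OF t] by simp
      then show "sqrt (m t) \<le> sqrt (\<phi> (t, 1) - \<phi> (t, b))" by (simp add: m_def)
    qed (simp add: integrable_const_ivl)
    also have "\<dots> \<le> integral {-1..1} (\<lambda>b. sqrt (\<phi> (t, 1) - \<phi> (t, b)))"
      by (rule integral_subset_le[OF _ int' int]) (use mono[OF t, of _ 1] in auto)
    finally show ?thesis by (simp add: sqrt_drift_def)
  qed
  have cd: "continuous_on {0..4} (sqrt_drift \<phi> 1)"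
    by (rule continuous_on_sqrt_drift[OF cont]) simp
  have "((\<lambda>t. 1 - integral {0..t} (sqrt_drift \<phi> 1)) has_real_derivative - sqrt_drift \<phi> 1 t) (at t within {0..4})"
    if "t \<in> {0..4}" for t
    using integral_has_real_derivative[OF cd that] by (auto intro!: derivative_eq_intros)
  then have m_deriv: "(m has_real_derivative - sqrt_drift \<phi> 1 t) (at t within {0..4})" if "t \<in> {0..4}" for t
    by (rule has_field_derivative_transform_within[OF _ zero_less_one that])
      (use that eq in \<open>auto simp: m_def\<close>)
  then have m_cont: "continuous_on {0..4} m"
    by (intro DERIV_continuous_on)
  have m_DERIV: "DERIV m t :> - sqrt_drift \<phi> 1 t" if "0 < t" "t < 4" for t
    using m_deriv[of t] at_within_Icc_at[of 0 t 4] that by simp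
  have "m 4 = 0"
  proof (rule ccontr)
    assume "m 4 \<noteq> 0"
    then have m4: "0 < m 4" using m_nonneg[of 4] by simp
    \<comment> \<open>Since \<open>m\<close> is nonincreasing, positivity at the final time gives
      positivity throughout, which makes \<open>sqrt (m t)\<close> differentiable.\<close>
    have m_pos: "0 < m t" if t: "t \<in> {0..4}" for t
    proof -
      have "m 4 \<le> m t"
      proof (rule DERIV_nonpos_imp_decreasing_open[of t 4 m])
        fix x assume x: "t < x" "x < 4"
        then have "0 \<le> sqrt_drift \<phi> 1 x"
          using order_trans[OF real_sqrt_ge_zero[OF m_nonneg[of x]] drift_ge[of x]] t by simp
        then show "\<exists>y. DERIV m x :> y \<and> y \<le> 0" using m_DERIV[of x] x t by auto
      qed (use t in \<open>auto intro: continuous_on_subset[OF m_cont]\<close>)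
      then show ?thesis using m4 by simp
    qed
    \<comment> \<open>From \<open>m' \<le> - sqrt m\<close> the root of \<open>m\<close> falls at
      rate at least 1/2. It starts at 1, so lasting until time 4 would require
      \<open>sqrt (m 4) + 2 \<le> 1\<close>.\<close>
    have "sqrt (m 4) + 4 / 2 \<le> sqrt (m 0) + 0 / 2"
    proof (rule DERIV_nonpos_imp_decreasing_open[of 0 4 "\<lambda>t. sqrt (m t) + t / 2"])
      fix x :: real assume x: "0 < x" "x < 4"
      define s where "s = sqrt (m x)"
      have s: "0 < s" "s \<le> sqrt_drift \<phi> 1 x"
        using m_pos[of x] drift_ge[of x] x by (auto simp: s_def)
      have "DERIV (\<lambda>t. sqrt (m t) + t / 2) x :> inverse s / 2 * - sqrt_drift \<phi> 1 x + 1 / 2"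
        unfolding s_def using x
        by (intro DERIV_add DERIV_chain2[OF DERIV_real_sqrt m_DERIV] m_pos DERIV_cdivide DERIV_ident) auto
      moreover have "inverse s / 2 * - sqrt_drift \<phi> 1 x + 1 / 2 \<le> 0"
        using s by (simp add: field_simps)
      ultimately show "\<exists>y. DERIV (\<lambda>t. sqrt (m t) + t / 2) x :> y \<and> y \<le> 0" by blast
    qed (auto intro!: continuous_intros m_cont)
    moreover have "m 0 = 1" using eq[of 0 1] by (simp add: m_def)
    ultimately show False using real_sqrt_gt_zero[OF m4] by simp
  qed
  \<comment> \<open>By oddness the left end point has collapsed too, and monotonicity squeezes all
    other particles between the two ends.\<close>
  moreover have "\<phi> (4, -1) = - \<phi> (4, 1)"
    using adm[of 4] by (simp add: admissible_def)
  ultimately show ?thesis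
    using mono[of 4 "-1" a] mono[of 4 a 1] a by (simp add: m_def)
qed

section \<open>Integration against the push-forward measure on the segment\<close>

lemma H1_I_integral:
  assumes cont: "continuous_on UNIV g" and B: "\<And>x. norm (g x) \<le> B"
  shows "integrable H1_I (g :: real \<times> real \<Rightarrow> real \<times> real)"
    and "integral\<^sup>L H1_I g = integral\<^sup>L (lebesgue_on {-1..1}) (\<lambda>b. g (b, 0))"
proof -
  have meas: "(\<lambda>a::real. (a, 0::real)) \<in> measurable (lebesgue_on {-1..1}) borel"
    by (intro continuous_imp_measurable_on_sets_lebesgue continuous_intros) simp
  have g: "g \<in> borel_measurable borel"
    by (rule borel_measurable_continuous_onI[OF cont])
  interpret finite_measure "lebesgue_on {-1..1::real}"
    by (rule finite_measure_lebesgue_on) simp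
  have "integrable (lebesgue_on {-1..1}) (\<lambda>b. g (b, 0))"
    by (rule integrable_const_bound[of _ B]) (use B measurable_compose[OF meas g] in auto)
  then show "integrable H1_I g"
    unfolding H1_I_def by (subst integrable_distr_eq[OF meas g])
  show "integral\<^sup>L H1_I g = integral\<^sup>L (lebesgue_on {-1..1}) (\<lambda>b. g (b, 0))"
    unfolding H1_I_def by (rule integral_distr[OF meas g])
qed

section \<open>Extension of the axis flow to all times and identification of its velocity\<close>

theorem theorem3p2:
  shows "\<exists>\<kappa> X. C11half_c \<kappa> \<and> continuous_on UNIV (perp_grad \<kappa>) \<and>
           admits_flow (perp_grad \<kappa>) X \<and>
           (\<forall>x \<in> segI. X 0 x = x) \<and>
           (\<exists>T>0. \<forall>t\<ge>T. X t ` segI = {(0, 0)})"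
proof -
  obtain \<kappa> where \<kappa>: "C11half_c \<kappa>" "continuous_on UNIV (perp_grad \<kappa>)"
    and axis: "\<And>x. \<bar>x\<bar> \<le> 2 \<Longrightarrow> perp_grad \<kappa> (x, 0) = (- sqrt x, 0)"
    and bdd: "\<exists>B. \<forall>x. norm (perp_grad \<kappa> x) \<le> B"
    by (rule ex_kernel) blast
  obtain B where B: "\<And>x. norm (perp_grad \<kappa> x) \<le> B" using bdd by blast
  obtain \<phi> where cont: "continuous_on ({0..4} \<times> {-1..1}) \<phi>"
    and adm: "\<And>t. t \<in> {0..4} \<Longrightarrow> admissible (\<lambda>a. \<phi> (t, a))"
    and eq: "\<And>t a. \<lbrakk>t \<in> {0..4}; a \<in> {-1..1}\<rbrakk> \<Longrightarrow> \<phi> (t, a) = a - integral {0..t} (sqrt_drift \<phi> a)"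
    by (rule ex_sqrt_flow[of 4]) blast
  have collapse: "\<phi> (4, a) = 0" if "a \<in> {-1..1}" for a
    by (rule sqrt_flow_collapses[OF cont adm eq that])
  \<comment> \<open>Clamping the label extends the flow continuously to all labels, so that the
    integrands below are continuous on the whole plane.\<close>
  define c where "c b = max (-1) (min 1 b)" for b :: real
  have c: "c b \<in> {-1..1}" "b \<in> {-1..1} \<Longrightarrow> c b = b" for b by (auto simp: c_def)
  have c_cont: "continuous_on S c" for S unfolding c_def by (intro continuous_intros)
  \<comment> \<open>The flow is stopped at time 4. This still solves the equation, because the
    collapsed state exerts no drift.\<close>
  define \<psi> where "\<psi> = (\<lambda>(t, b). \<phi> (min t 4, c b))"
  have \<psi>_cont: "continuous_on ({0..} \<times> S) \<psi>" for S
    unfolding \<psi>_def case_prod_beta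
    by (intro continuous_on_compose2[OF cont] continuous_intros continuous_on_compose2[OF c_cont[of UNIV]])
      (auto simp: c_def)
  have \<psi>_eq: "\<psi> (t, b) = \<phi> (t, b)" if "t \<in> {0..4}" "b \<in> {-1..1}" for t b
    using that c(2) by (simp add: \<psi>_def)
  have \<psi>_zero: "\<psi> (t, b) = 0" if "4 \<le> t" for t b
    using that collapse[OF c(1)] by (simp add: \<psi>_def min_def)
  \<comment> \<open>The bound 2 keeps all differences of positions in the range where the kernel on
    the axis is exactly the negative odd square root.\<close>
  have \<psi>_near: "\<bar>\<psi> (t, a) - \<psi> (t, b)\<bar> \<le> 2" if "0 \<le> t" for t a b
    using admissible_bound[OF adm[of "min t 4"] c(1) c(1)] that by (simp add: \<psi>_def)
  define X where "X t p = (\<psi> (t, fst p), 0 :: real)" for t and p :: "real \<times> real"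
  have K_X: "perp_grad \<kappa> (X t a - X t b) = (- sqrt (\<psi> (t, fst a) - \<psi> (t, fst b)), 0)" if "0 \<le> t" for t a b
    using axis[OF \<psi>_near[OF that]] by (simp add: X_def)
  have K_cont: "continuous_on UNIV (\<lambda>p. perp_grad \<kappa> (x - X t p))" if "0 \<le> t" for t x
    unfolding X_def
    by (intro continuous_on_compose2[OF \<kappa>(2)] continuous_intros
        continuous_on_compose2[OF \<psi>_cont[of UNIV], of _ "\<lambda>p. (t, fst p)"]) (use that in auto)
  have K_int: "integrable H1_I (\<lambda>p. perp_grad \<kappa> (x - X t p))" if "0 \<le> t" for t x
    by (rule H1_I_integral(1)[OF K_cont[OF that] B])
  have \<psi>_int: "\<psi> (t, a) = a - integral {0..t} (sqrt_drift \<psi> a)" if t: "0 \<le> t" and a: "a \<in> {-1..1}" for t a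
  proof -
    have small: "\<psi> (t, a) = a - integral {0..t} (sqrt_drift \<psi> a)" if t: "t \<in> {0..4}" for t
    proof -
      have "sqrt_drift \<psi> a s = sqrt_drift \<phi> a s" if "s \<in> {0..t}" for s
        unfolding sqrt_drift_def using that t a by (intro integral_cong) (simp add: \<psi>_eq)
      then have "integral {0..t} (sqrt_drift \<psi> a) = integral {0..t} (sqrt_drift \<phi> a)"
        by (rule integral_cong)
      then show ?thesis using eq[OF t a] \<psi>_eq[OF t a] by simp
    qed
    show ?thesis
    proof (cases "t \<le> 4")
      case False
      have "integral {4..t} (sqrt_drift \<psi> a) = integral {4..t} (\<lambda>_. 0)"
        by (rule integral_cong) (simp add: sqrt_drift_def \<psi>_zero)
      moreover have "integral {0..4} (sqrt_drift \<psi> a) + integral {4..t} (sqrt_drift \<psi> a)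
          = integral {0..t} (sqrt_drift \<psi> a)"
        by (rule Henstock_Kurzweil_Integration.integral_combine)
          (use False a in \<open>auto intro!: integrable_continuous_real
            continuous_on_subset[OF continuous_on_sqrt_drift(1)[OF \<psi>_cont]]\<close>)
      ultimately show ?thesis using small[of 4] \<psi>_zero[of t a] \<psi>_zero[of 4 a] False by simp
    qed (use small t in simp)
  qed
  have vel_X: "vel (perp_grad \<kappa>) X t (X t a) = (- sqrt_drift \<psi> (fst a) t, 0)"
    if "0 \<le> t" "a \<in> segI" for t a
  proof -
    have a: "fst a \<in> {-1..1}" using that(2) by (auto simp: segI_def)
    define f where "f b = sqrt (\<psi> (t, fst a) - \<psi> (t, b))" for b
    have f_cont: "continuous_on {-1..1} f"
      unfolding f_def
      by (intro continuous_intros continuous_on_compose2[OF \<psi>_cont[of UNIV], of _ "\<lambda>b. (t, b)"])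
        (use that in auto)
    have f_int: "integrable (lebesgue_on {-1..1}) f"
      by (rule continuous_imp_integrable_real[OF f_cont])
    have "vel (perp_grad \<kappa>) X t (X t a) = (LINT b|lebesgue_on {-1..1}. perp_grad \<kappa> (X t a - X t (b, 0)))"
      unfolding vel_def by (rule H1_I_integral(2)[OF K_cont[OF that(1)] B])
    \<comment> \<open>Writing the vector integrand as a scalar multiple of a fixed vector reduces it
      to a real integral, which is then identified with the gauge integral in
      \<open>sqrt_drift\<close>.\<close>
    also have "\<dots> = (LINT b|lebesgue_on {-1..1}. f b *\<^sub>R (- 1, 0))"
      unfolding K_X[OF that(1)] by (simp add: f_def)
    also have "\<dots> = (LINT b|lebesgue_on {-1..1}. f b) *\<^sub>R (- 1, 0)"
      by (rule integral_scaleR_left) (use f_int in simp)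
    also have "(LINT b|lebesgue_on {-1..1}. f b) = sqrt_drift \<psi> (fst a) t"
      using lebesgue_integral_eq_integral[OF f_int] by (simp add: f_def[abs_def] sqrt_drift_def)
    finally show ?thesis by simp
  qed
  have X0: "X 0 a = a" if "a \<in> segI" for a
    using that \<psi>_int[of 0] by (auto simp: X_def segI_def)
  have X_deriv: "((\<lambda>s. X s a) has_vector_derivative vel (perp_grad \<kappa>) X t (X t a)) (at t within {0..})"
    if t: "0 \<le> t" and a: "a \<in> segI" for t a
  proof -
    have a': "fst a \<in> {-1..1}" using a by (auto simp: segI_def)
    have "continuous_on {0..t + 1} (sqrt_drift \<psi> (fst a))"
      by (rule continuous_on_subset[OF continuous_on_sqrt_drift(1)[OF \<psi>_cont a']]) auto
    from integral_has_vector_derivative[OF this, of t]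
    have "((\<lambda>s. integral {0..s} (sqrt_drift \<psi> (fst a))) has_vector_derivative sqrt_drift \<psi> (fst a) t)
        (at t within {0..t + 1})"
      using t by simp
    \<comment> \<open>The fundamental theorem of calculus is available on a compact interval; ending
      it at \<open>t + 1\<close> leaves \<open>t\<close> away from the artificial right end, so the
      one-sided filter is that of the half-line.\<close>
    moreover have "at t within {0..t + 1} = at t within {0..}"
      by (rule at_within_nhd[of t "{..<t + 1}"]) auto
    ultimately have "((\<lambda>s. fst a - integral {0..s} (sqrt_drift \<psi> (fst a))) has_vector_derivative
        0 - sqrt_drift \<psi> (fst a) t) (at t within {0..})"
      by (intro has_vector_derivative_diff has_vector_derivative_const) simp
    then have "((\<lambda>s. \<psi> (s, fst a)) has_vector_derivative 0 - sqrt_drift \<psi> (fst a) t) (at t within {0..})"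
      by (rule has_vector_derivative_transform[rotated 2]) (use t \<psi>_int a' in auto)
    then have "((\<lambda>s. (\<psi> (s, fst a), 0::real)) has_vector_derivative (0 - sqrt_drift \<psi> (fst a) t, 0)) (at t within {0..})"
      by (intro has_vector_derivative_Pair has_vector_derivative_const)
    then show ?thesis unfolding vel_X[OF t a] by (simp add: X_def)
  qed
  have X_cont: "continuous_on ({0..} \<times> segI) (\<lambda>(t, a). X t a)"
    unfolding X_def case_prod_beta
    by (intro continuous_intros continuous_on_compose2[OF \<psi>_cont[of UNIV], of _ "\<lambda>p. (fst p, fst (snd p))"])
      auto
  have "X t ` segI = {(0, 0)}" if "4 \<le> t" for t
  proof -
    have "(0, 0) \<in> segI" by (simp add: segI_def)
    moreover have "X t a = (0, 0)" for a using \<psi>_zero[OF that] by (simp add: X_def)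
    ultimately show ?thesis by auto
  qed
  moreover have "admits_flow (perp_grad \<kappa>) X"
    unfolding admits_flow_def using X_cont K_int X0 X_deriv by blast
  ultimately show ?thesis
    using \<kappa> X0 by (intro exI[of _ \<kappa>] exI[of _ X] conjI exI[of _ 4]) auto
qed

end
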